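(* Let $\varphi\in F^\infty$. Then $\varphi$ is invertible in $F^\infty$ if and only if $\varphi$ is outer and there exists $\delta>0$ such that $\|\varphi\otimes p\|_2\ge\delta\|p\|_2$ for every $p\in\mathcal P$.
   Context: Fix an integer $n\ge 1$ and $\Lambda=\{1,\dots,n\}$. Let $\mathcal F$ be the set of all finite words in $\Lambda$, i.e. functions $f:\{1,\dots,k\}\to\Lambda$, $k\ge 0$, the empty word being denoted $0$. The full Fock space $\mathcal F^2(\mathcal H_n)$ is the complex Hilbert space with orthonormal basis $\{e_f: f\in\mathcal F\}$, where $e_0=1$ and $e_f=e_{f(1)}\otimes\cdots\otimes e_{f(k)}$. The product $\otimes$ is the bilinear extension of concatenation of words: $\langle \varphi\otimes\psi,e_h\rangle=\sum_{e_f\otimes e_g=e_h}\langle\varphi,e_f\rangle\langle\psi,e_g\rangle$ (a finite sum). $\mathcal P=\mathrm{span}\{e_f:f\in\mathcal F\}$ is the set of polynomials; $\|\cdot\|_2$ is the norm of $\mathcal F^2(\mathcal H_n)$. $F^\infty$ is the set of all $g\in\mathcal F^2(\mathcal H_n)$ with $\|g\|_\infty=\sup\{\|g\otimes p\|_2: p\in\mathcal P,\ \|p\|_2\le 1\}<\infty$; it is a Banach algebra under $\otimes$ with unit $e_0=1$. $\varphi\in F^\infty$ is outer if $\varphi\otimes\mathcal F^2(\mathcal H_n)$ is dense in $\mathcal F^2(\mathcal H_n)$. *)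

theory Defs
  imports "HOL-Analysis.Analysis" "HOL-Library.Function_Algebras"
begin

text \<open>
  Finite words over the alphabet \<open>\<Lambda>\<close> are lists over a (nonempty) finite type \<open>'n\<close>, with
  \<open>n = CARD('n)\<close>; the empty word is \<open>[]\<close>. An element \<open>\<phi>\<close> of the full Fock space is represented by
  its family of coefficients with respect to the orthonormal basis \<open>e\<^sub>f\<close>, that is
  \<open>\<phi> f = \<langle>\<phi>, e\<^sub>f\<rangle>\<close>. Sums, differences and \<open>0\<close> of such families are pointwise
  (theory \<open>Function_Algebras\<close>).
\<close>

type_synonym 'n coeffs = "'n list \<Rightarrow> complex"

definition fock :: "('n::finite) coeffs set" where
  "fock = {\<phi>. (\<lambda>f. (cmod (\<phi> f))\<^sup>2) summable_on UNIV}"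

text \<open>Only meaningful on \<^const>\<open>fock\<close>: elsewhere \<^const>\<open>infsum\<close> defaults to \<open>0\<close>.\<close>

definition norm2 :: "('n::finite) coeffs \<Rightarrow> real" where
  "norm2 \<phi> = sqrt (\<Sum>\<^sub>\<infinity>f. (cmod (\<phi> f))\<^sup>2)"

definition fock_topology :: "('n::finite) coeffs topology" where
  "fock_topology = Metric_space.mtopology fock (\<lambda>\<phi> \<psi>. norm2 (\<phi> - \<psi>))"

definition fock_basis :: "('n::finite) list \<Rightarrow> 'n coeffs" where
  "fock_basis f = (\<lambda>h. if h = f then 1 else 0)"

definition fock_scale :: "complex \<Rightarrow> ('n::finite) coeffs \<Rightarrow> 'n coeffs" where
  "fock_scale c \<phi> = (\<lambda>f. c * \<phi> f)"

definition fock_poly :: "('n::finite) coeffs set" where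
  "fock_poly = module.span fock_scale (range fock_basis)"

text \<open>
  The product of two elements of \<^const>\<open>fock\<close> is always defined as a family of coefficients, but
  need not be square summable again.
\<close>

definition fock_mult :: "('n::finite) coeffs \<Rightarrow> 'n coeffs \<Rightarrow> 'n coeffs"
    (infixl \<open>\<otimes>\<^sub>F\<close> 70) where
  "\<phi> \<otimes>\<^sub>F \<psi> = (\<lambda>h. \<Sum>(f, g) | f @ g = h. \<phi> f * \<psi> g)"

definition norm_inf :: "('n::finite) coeffs \<Rightarrow> ennreal" where
  "norm_inf g = (SUP p \<in> {p \<in> fock_poly. norm2 p \<le> 1}. ennreal (norm2 (g \<otimes>\<^sub>F p)))"

definition F_inf :: "('n::finite) coeffs set" where
  "F_inf = {g \<in> fock. norm_inf g < \<infinity>}"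

definition invertible_F_inf :: "('n::finite) coeffs \<Rightarrow> bool" where
  "invertible_F_inf \<phi> \<longleftrightarrow>
     (\<exists>\<psi>\<in>F_inf. \<phi> \<otimes>\<^sub>F \<psi> = fock_basis [] \<and> \<psi> \<otimes>\<^sub>F \<phi> = fock_basis [])"

text \<open>
  \<^const>\<open>closure_of\<close> intersects its argument with \<^const>\<open>fock\<close>, so an element of the image that is
  not square summable could not count towards density.
\<close>

definition outer :: "('n::finite) coeffs \<Rightarrow> bool" where
  "outer \<phi> \<longleftrightarrow> \<phi> \<in> F_inf \<and>
     fock_topology closure_of ((\<lambda>\<psi>. \<phi> \<otimes>\<^sub>F \<psi>) ` fock) = fock"

lemma finite_append_eq: "finite {(f, g). f @ g = h}"
proof -
  have "(f, g) \<in> (\<lambda>k. (take k h, drop k h)) ` {..length h}" if "f @ g = h" for f g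
  proof -
    have "(f, g) = (take (length f) h, drop (length f) h)" and "length f \<le> length h"
      using that by auto
    then show ?thesis
      by blast
  qed
  then have "{(f, g). f @ g = h} \<subseteq> (\<lambda>k. (take k h, drop k h)) ` {..length h}"
    by blast
  then show ?thesis
    by (rule finite_subset) auto
qed

lemma norm2_nonneg: "0 \<le> norm2 \<phi>"
  by (simp add: norm2_def infsum_nonneg)

lemma norm2_power2: "(norm2 \<phi>)\<^sup>2 = (\<Sum>\<^sub>\<infinity>f. (cmod (\<phi> f))\<^sup>2)"
  by (simp add: norm2_def infsum_nonneg)

lemma L2_set_le_norm2:
  assumes "\<phi> \<in> fock" and "finite A"
  shows "L2_set (\<lambda>f. cmod (\<phi> f)) A \<le> norm2 \<phi>"
  unfolding L2_set_def norm2_def using assms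
  by (intro real_sqrt_le_mono finite_sum_le_infsum) (auto simp: fock_def)

lemma fock_bound:
  assumes "\<And>A. finite A \<Longrightarrow> L2_set (\<lambda>f. cmod (\<phi> f)) A \<le> B"
  shows "\<phi> \<in> fock" and "norm2 \<phi> \<le> B"
proof -
  have B: "0 \<le> B"
    using assms[of "{}"] by simp
  have le: "(\<Sum>f\<in>A. (cmod (\<phi> f))\<^sup>2) \<le> B\<^sup>2" if "finite A" for A
    using assms[OF that] B unfolding L2_set_def by (metis real_sqrt_le_iff real_sqrt_abs abs_of_nonneg)
  show *: "\<phi> \<in> fock"
    unfolding fock_def
    by (auto intro!: nonneg_bdd_above_summable_on bdd_aboveI2[where M = "B\<^sup>2"] le)
  then have "(\<Sum>\<^sub>\<infinity>f. (cmod (\<phi> f))\<^sup>2) \<le> B\<^sup>2"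
    by (intro infsum_le_finite_sums) (auto simp: fock_def le)
  then show "norm2 \<phi> \<le> B"
    using B by (metis norm2_power2 power2_le_imp_le)
qed

lemma fock_add:
  assumes "\<phi> \<in> fock" and "\<psi> \<in> fock"
  shows "\<phi> + \<psi> \<in> fock" and "norm2 (\<phi> + \<psi>) \<le> norm2 \<phi> + norm2 \<psi>"
proof -
  have "L2_set (\<lambda>f. cmod ((\<phi> + \<psi>) f)) A \<le> norm2 \<phi> + norm2 \<psi>" if "finite A" for A
  proof -
    have "L2_set (\<lambda>f. cmod ((\<phi> + \<psi>) f)) A \<le> L2_set (\<lambda>f. cmod (\<phi> f) + cmod (\<psi> f)) A"
      by (intro L2_set_mono) (auto simp: norm_triangle_ineq)
    also have "\<dots> \<le> L2_set (\<lambda>f. cmod (\<phi> f)) A + L2_set (\<lambda>f. cmod (\<psi> f)) A"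
      by (rule L2_set_triangle_ineq)
    also have "\<dots> \<le> norm2 \<phi> + norm2 \<psi>"
      using assms that by (intro add_mono L2_set_le_norm2)
    finally show ?thesis .
  qed
  then show "\<phi> + \<psi> \<in> fock" and "norm2 (\<phi> + \<psi>) \<le> norm2 \<phi> + norm2 \<psi>"
    by (blast intro: fock_bound)+
qed

lemma fock_scale_in_fock: "\<phi> \<in> fock \<Longrightarrow> fock_scale c \<phi> \<in> fock"
  by (auto simp: fock_def fock_scale_def norm_mult power_mult_distrib intro: summable_on_cmult_right)

lemma fock_uminus: "\<phi> \<in> fock \<Longrightarrow> - \<phi> \<in> fock"
  by (simp add: fock_def)

lemma fock_diff: "\<phi> \<in> fock \<Longrightarrow> \<psi> \<in> fock \<Longrightarrow> \<phi> - \<psi> \<in> fock"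
  using fock_add(1)[of \<phi> "- \<psi>"] fock_uminus[of \<psi>] by simp

lemma norm2_eq_0_iff:
  assumes "\<phi> \<in> fock"
  shows "norm2 \<phi> = 0 \<longleftrightarrow> \<phi> = 0"
proof
  assume 0: "norm2 \<phi> = 0"
  have "cmod (\<phi> f) \<le> 0" for f
    using L2_set_le_norm2[OF assms, of "{f}"] 0 by (simp add: L2_set_def)
  then show "\<phi> = 0"
    by (simp add: fun_eq_iff)
qed (simp add: norm2_def)

lemma Metric_space_fock:
  "Metric_space (fock :: ('n::finite) coeffs set) (\<lambda>\<phi> \<psi>. norm2 (\<phi> - \<psi>))"
proof
  fix \<phi> \<psi> \<theta> :: "'n coeffs"
  show "0 \<le> norm2 (\<phi> - \<psi>)"
    by (rule norm2_nonneg)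
  show "norm2 (\<phi> - \<psi>) = norm2 (\<psi> - \<phi>)"
    by (simp add: norm2_def norm_minus_commute)
  assume "\<phi> \<in> fock" and "\<psi> \<in> fock"
  then show "norm2 (\<phi> - \<psi>) = 0 \<longleftrightarrow> \<phi> = \<psi>"
    by (simp add: norm2_eq_0_iff fock_diff)
  assume "\<theta> \<in> fock"
  then show "norm2 (\<phi> - \<theta>) \<le> norm2 (\<phi> - \<psi>) + norm2 (\<psi> - \<theta>)"
    using fock_add(2)[of "\<phi> - \<psi>" "\<psi> - \<theta>"] \<open>\<phi> \<in> fock\<close> \<open>\<psi> \<in> fock\<close> by (simp add: fock_diff)
qed

lemma module_fock_scale: "module (fock_scale :: complex \<Rightarrow> ('n::finite) coeffs \<Rightarrow> 'n coeffs)"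
  by standard (auto simp: fock_scale_def fun_eq_iff algebra_simps)

lemma fock_basis_in_fock: "fock_basis f \<in> fock"
proof -
  have "(\<lambda>h. (cmod (fock_basis f h))\<^sup>2) summable_on {f}"
    by simp
  then show ?thesis
    unfolding fock_def fock_basis_def
    by (simp, subst summable_on_cong_neutral[where T = "{f}"]) auto
qed

lemma fock_mult_basis:
  "(\<phi> \<otimes>\<^sub>F fock_basis g) h = (\<Sum>f | f @ g = h. \<phi> f)"
proof -
  have "(\<phi> \<otimes>\<^sub>F fock_basis g) h = (\<Sum>x \<in> (\<lambda>f. (f, g)) ` {f. f @ g = h}. \<phi> (fst x))"
    unfolding fock_mult_def
    by (rule sum.mono_neutral_cong_right[OF finite_append_eq]) (auto simp: fock_basis_def)
  also have "\<dots> = (\<Sum>f | f @ g = h. \<phi> f)"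
    by (subst sum.reindex) (auto simp: inj_on_def)
  finally show ?thesis .
qed

lemma fock_mult_basis_in_fock:
  assumes "\<phi> \<in> fock"
  shows "\<phi> \<otimes>\<^sub>F fock_basis g \<in> fock"
proof -
  let ?F = "\<lambda>h. (cmod ((\<phi> \<otimes>\<^sub>F fock_basis g) h))\<^sup>2"
  have "{f'. f' @ g = f @ g} = {f}" for f
    by auto
  then have "(?F \<circ> (\<lambda>f. f @ g)) summable_on UNIV"
    using assms by (simp add: fock_def fock_mult_basis o_def)
  then have "?F summable_on range (\<lambda>f. f @ g)"
    by (subst summable_on_reindex) (auto simp: inj_on_def)
  moreover have "?F h = 0" if "h \<notin> range (\<lambda>f. f @ g)" for h
  proof -
    from that have "{f. f @ g = h} = {}"
      by auto
    then show ?thesis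
      by (simp add: fock_mult_basis)
  qed
  ultimately show ?thesis
    unfolding fock_def
    by (simp, subst summable_on_cong_neutral[where T = "range (\<lambda>f. f @ g)"]) auto
qed

text \<open>
  Right multiplication by a polynomial maps \<^const>\<open>fock\<close> into itself, so \<^const>\<open>norm_inf\<close> never
  evaluates \<^const>\<open>norm2\<close> outside \<^const>\<open>fock\<close> when its argument is in \<^const>\<open>fock\<close>.
\<close>

lemma fock_mult_poly_in_fock:
  assumes "\<phi> \<in> fock" and "p \<in> fock_poly"
  shows "\<phi> \<otimes>\<^sub>F p \<in> fock"
proof -
  interpret module "fock_scale :: complex \<Rightarrow> 'a coeffs \<Rightarrow> 'a coeffs"
    by (rule module_fock_scale)
  from assms(2) show ?thesis
    unfolding fock_poly_def
  proof (induction rule: span_induct_alt)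
    case base
    have "\<phi> \<otimes>\<^sub>F 0 = 0"
      by (simp add: fock_mult_def fun_eq_iff case_prod_unfold)
    moreover have "0 \<in> fock"
      by (simp add: fock_def)
    ultimately show ?case
      by (simp only:)
  next
    case (step c x y)
    have "\<phi> \<otimes>\<^sub>F (fock_scale c x + y) = fock_scale c (\<phi> \<otimes>\<^sub>F x) + \<phi> \<otimes>\<^sub>F y"
      by (simp add: fock_mult_def fock_scale_def fun_eq_iff case_prod_unfold sum_distrib_left
          sum.distrib algebra_simps)
    moreover have "\<dots> \<in> fock"
      using step assms(1) by (intro fock_add(1) fock_scale_in_fock) (auto simp: fock_mult_basis_in_fock)
    ultimately show ?case
      by (simp only:)
  qed
qed

lemma fock_poly_eq: "fock_poly = {p. finite {f. p f \<noteq> 0}}"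
proof -
  interpret module "fock_scale :: complex \<Rightarrow> 'a coeffs \<Rightarrow> 'a coeffs"
    by (rule module_fock_scale)
  have "finite {f. p f \<noteq> 0}" if "p \<in> span (range fock_basis)" for p :: "'a coeffs"
    using that
  proof (induction rule: span_induct_alt)
    case base
    then show ?case by simp
  next
    case (step c x y)
    then obtain f where "x = fock_basis f" by auto
    then have "{h. (fock_scale c x + y) h \<noteq> 0} \<subseteq> insert f {h. y h \<noteq> 0}"
      by (auto simp: fock_scale_def fock_basis_def split: if_splits)
    then show ?case
      using step by (auto intro: finite_subset)
  qed
  moreover have "p \<in> span (range fock_basis)" if "finite {f. p f \<noteq> 0}" for p :: "'a coeffs"
  proof -
    have sum_apply: "(\<Sum>f\<in>A. F f) h = (\<Sum>f\<in>A. F f h)" 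
      for A and F :: "'a list \<Rightarrow> 'a coeffs" and h
      by (induction A rule: infinite_finite_induct) auto
    have "p = (\<Sum>f | p f \<noteq> 0. fock_scale (p f) (fock_basis f))"
      using that by (auto simp: fun_eq_iff sum_apply fock_scale_def fock_basis_def if_distrib
          sum.delta cong: if_cong)
    also have "\<dots> \<in> span (range fock_basis)"
      by (intro span_sum span_scale span_base) auto
    finally show ?thesis .
  qed
  ultimately show ?thesis
    unfolding fock_poly_def by blast
qed

end

theory Submission
  imports Defs
begin

text \<open>
  If \<open>\<phi>\<close> has an inverse \<open>\<psi>\<close> in \<^const>\<open>F_inf\<close>, both directions of boundedness are at hand:
  \<open>h = \<phi> \<otimes>\<^sub>F (\<psi> \<otimes>\<^sub>F h)\<close> shows that left multiplication by \<open>\<phi>\<close> is onto, and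
  \<open>p = \<psi> \<otimes>\<^sub>F (\<phi> \<otimes>\<^sub>F p)\<close> bounds \<open>p\<close> by a multiple of \<open>\<phi> \<otimes>\<^sub>F p\<close>. This uses that the bound which
  defines \<^const>\<open>F_inf\<close> passes from polynomials to all of \<^const>\<open>fock\<close> (\<open>F_inf_bounded\<close>).

  For the converse, the inverse is first found as a formal power series. Families of coefficients
  form a ring under \<open>\<otimes>\<^sub>F\<close>, and there \<open>\<phi>\<close> has a two-sided inverse \<open>\<psi>\<close> as soon as its
  constant coefficient \<open>\<phi> []\<close> is nonzero (\<open>fock_mult_inverse_exists\<close>); an outer \<open>\<phi>\<close> has this
  property, since the constant coefficient of \<open>\<phi> \<otimes>\<^sub>F g\<close> is \<open>\<phi> [] * g []\<close>, which must come close
  to \<open>1\<close>. Only analytic control of \<open>\<psi>\<close> remains. Outerness gives \<open>g\<^sub>k\<close> in \<^const>\<open>fock\<close> with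
  \<open>\<phi> \<otimes>\<^sub>F g\<^sub>k\<close> converging to the unit. The lower bound, extended from polynomials to
  \<^const>\<open>fock\<close> (\<open>lower_bound_extends\<close>), keeps the \<open>g\<^sub>k\<close> bounded in norm, while
  \<open>g\<^sub>k = \<psi> \<otimes>\<^sub>F (\<phi> \<otimes>\<^sub>F g\<^sub>k)\<close> converges to \<open>\<psi>\<close> coefficient by coefficient, because a coefficient of
  a product is a finite sum. A coefficientwise limit of a bounded sequence is square summable
  (\<open>fock_bound_of_coeff_limit\<close>), so \<open>\<psi>\<close> lies in \<^const>\<open>fock\<close>. Finally, applying the lower bound to \<open>\<psi> \<otimes>\<^sub>F p\<close> gives
  \<open>\<delta> * norm2 (\<psi> \<otimes>\<^sub>F p) \<le> norm2 p\<close>, so \<open>\<psi>\<close> lies in \<^const>\<open>F_inf\<close>.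
\<close>

section \<open>The ring of formal power series in noncommuting variables\<close>

lemma fock_mult_assoc: "(\<phi> \<otimes>\<^sub>F \<psi>) \<otimes>\<^sub>F \<theta> = \<phi> \<otimes>\<^sub>F (\<psi> \<otimes>\<^sub>F \<theta>)"
proof
  fix h
  let ?S = "\<lambda>h. {(f, g). f @ g = h}"
  have "((\<phi> \<otimes>\<^sub>F \<psi>) \<otimes>\<^sub>F \<theta>) h =
      (\<Sum>x\<in>?S h. \<Sum>y\<in>?S (fst x). \<phi> (fst y) * \<psi> (snd y) * \<theta> (snd x))"
    by (simp add: fock_mult_def case_prod_unfold sum_distrib_right)
  also have "\<dots> = (\<Sum>(x, y)\<in>Sigma (?S h) (\<lambda>x. ?S (fst x)). \<phi> (fst y) * \<psi> (snd y) * \<theta> (snd x))"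
    by (rule sum.Sigma) (auto simp only: finite_append_eq)
  also have "\<dots> = (\<Sum>(x, y)\<in>Sigma (?S h) (\<lambda>x. ?S (snd x)). \<phi> (fst x) * (\<psi> (fst y) * \<theta> (snd y)))"
    by (rule sum.reindex_bij_witness[where
          i = "\<lambda>((a, g), (b, c)). ((a @ b, c), (a, b))" and
          j = "\<lambda>((f, c), (a, b)). ((a, b @ c), (b, c))"]) auto
  also have "\<dots> = (\<Sum>x\<in>?S h. \<Sum>y\<in>?S (snd x). \<phi> (fst x) * (\<psi> (fst y) * \<theta> (snd y)))"
    by (rule sum.Sigma[symmetric]) (auto simp only: finite_append_eq)
  also have "\<dots> = (\<phi> \<otimes>\<^sub>F (\<psi> \<otimes>\<^sub>F \<theta>)) h"
    by (simp add: fock_mult_def case_prod_unfold sum_distrib_left)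
  finally show "((\<phi> \<otimes>\<^sub>F \<psi>) \<otimes>\<^sub>F \<theta>) h = (\<phi> \<otimes>\<^sub>F (\<psi> \<otimes>\<^sub>F \<theta>)) h" .
qed

lemma fock_mult_unit_right [simp]: "\<phi> \<otimes>\<^sub>F fock_basis [] = \<phi>"
  by (simp add: fun_eq_iff fock_mult_basis)

lemma fock_mult_eq_sum_splits:
  "(\<phi> \<otimes>\<^sub>F \<psi>) h = (\<Sum>k\<le>length h. \<phi> (take k h) * \<psi> (drop k h))"
  unfolding fock_mult_def
  by (rule sum.reindex_bij_witness[where
        i = "\<lambda>k. (take k h, drop k h)" and j = "\<lambda>(f, g). length f"]) auto

lemma fock_mult_unit_left [simp]: "fock_basis [] \<otimes>\<^sub>F \<phi> = \<phi>"
proof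
  fix h
  have "(fock_basis [] \<otimes>\<^sub>F \<phi>) h = (\<Sum>k\<le>length h. if k = 0 then \<phi> h else 0)"
    unfolding fock_mult_eq_sum_splits by (rule sum.cong) (auto simp: fock_basis_def)
  then show "(fock_basis [] \<otimes>\<^sub>F \<phi>) h = \<phi> h"
    by simp
qed

lemma fock_mult_diff_right: "\<phi> \<otimes>\<^sub>F (\<psi> - \<theta>) = \<phi> \<otimes>\<^sub>F \<psi> - \<phi> \<otimes>\<^sub>F \<theta>"
  by (simp add: fock_mult_def fun_eq_iff case_prod_unfold sum_subtractf algebra_simps)

lemma fock_mult_scale_right: "\<phi> \<otimes>\<^sub>F fock_scale c \<psi> = fock_scale c (\<phi> \<otimes>\<^sub>F \<psi>)"
  by (simp add: fock_mult_def fock_scale_def fun_eq_iff case_prod_unfold sum_distrib_left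
      algebra_simps)

lemma fock_mult_Nil: "(\<phi> \<otimes>\<^sub>F \<psi>) [] = \<phi> [] * \<psi> []"
  by (simp add: fock_mult_eq_sum_splits)

lemma tendsto_fock_mult_right:
  assumes "\<And>h. ((\<lambda>k. u k h) \<longlongrightarrow> v h) F"
  shows "((\<lambda>k. (\<phi> \<otimes>\<^sub>F u k) h) \<longlongrightarrow> (\<phi> \<otimes>\<^sub>F v) h) F"
  unfolding fock_mult_eq_sum_splits by (intro tendsto_intros assms)

text \<open>
  The coefficient equations of \<open>\<phi> \<otimes>\<^sub>F \<psi> = e\<^sub>0\<close>, solved for \<open>\<psi> h\<close> by recursion on the length of \<open>h\<close>.
\<close>

function formal_inverse :: "('n::finite) coeffs \<Rightarrow> 'n coeffs" where
  "formal_inverse \<phi> h =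
     (fock_basis [] h - (\<Sum>k\<in>{1..length h}. \<phi> (take k h) * formal_inverse \<phi> (drop k h))) / \<phi> []"
  by auto
termination
  by (relation "Wellfounded.measure (length \<circ> snd)") auto

declare formal_inverse.simps [simp del]

lemma fock_mult_formal_inverse:
  fixes \<phi> :: "('n::finite) coeffs"
  assumes "\<phi> [] \<noteq> 0"
  shows "\<phi> \<otimes>\<^sub>F formal_inverse \<phi> = fock_basis []"
proof
  fix h :: "'n list"
  have "{..length h} = insert 0 {1..length h}"
    by auto
  then have "(\<phi> \<otimes>\<^sub>F formal_inverse \<phi>) h =
      \<phi> [] * formal_inverse \<phi> h + (\<Sum>k\<in>{1..length h}. \<phi> (take k h) * formal_inverse \<phi> (drop k h))"
    by (simp add: fock_mult_eq_sum_splits)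
  also have "\<dots> = fock_basis [] h"
    using assms by (subst formal_inverse.simps) simp
  finally show "(\<phi> \<otimes>\<^sub>F formal_inverse \<phi>) h = fock_basis [] h" .
qed

text \<open>
  A right inverse \<open>\<psi>\<close> again has nonzero constant coefficient, so it has a right inverse itself;
  by associativity that one must be \<open>\<phi>\<close>.
\<close>

lemma fock_mult_inverse_exists:
  fixes \<phi> :: "('n::finite) coeffs"
  assumes "\<phi> [] \<noteq> 0"
  obtains \<psi> where "\<phi> \<otimes>\<^sub>F \<psi> = fock_basis []" and "\<psi> \<otimes>\<^sub>F \<phi> = fock_basis []"
proof -
  define \<psi> where "\<psi> = formal_inverse \<phi>"
  define \<theta> where "\<theta> = formal_inverse \<psi>"
  have 1: "\<phi> \<otimes>\<^sub>F \<psi> = fock_basis []"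
    unfolding \<psi>_def using assms by (rule fock_mult_formal_inverse)
  then have "\<phi> [] * \<psi> [] = 1"
    by (metis fock_mult_Nil fock_basis_def)
  then have 2: "\<psi> \<otimes>\<^sub>F \<theta> = fock_basis []"
    unfolding \<theta>_def by (intro fock_mult_formal_inverse) auto
  have "\<phi> = \<phi> \<otimes>\<^sub>F (\<psi> \<otimes>\<^sub>F \<theta>)"
    by (simp add: 2)
  also have "\<dots> = \<theta>"
    by (simp add: 1 flip: fock_mult_assoc)
  finally show thesis
    using that 1 2 by blast
qed

section \<open>Polynomial truncations\<close>

lemma norm2_scale: "norm2 (fock_scale c \<phi>) = cmod c * norm2 \<phi>"
  by (simp add: norm2_def fock_scale_def norm_mult power_mult_distrib infsum_cmult_right'
      real_sqrt_mult)

lemma norm2_minus_commute: "norm2 (\<phi> - \<psi>) = norm2 (\<psi> - \<phi>)"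
  by (simp add: norm2_def norm_minus_commute)

lemma cmod_le_norm2: "\<phi> \<in> fock \<Longrightarrow> cmod (\<phi> h) \<le> norm2 \<phi>"
  using L2_set_le_norm2[of \<phi> "{h}"] by (simp add: L2_set_def)

lemma norm2_unit: "norm2 (fock_basis [] :: ('n::finite) coeffs) = 1"
proof -
  let ?e = "fock_basis [] :: 'n coeffs"
  have "(\<Sum>\<^sub>\<infinity>f. (cmod (?e f))\<^sup>2) = (\<Sum>\<^sub>\<infinity>f\<in>{[]}. (cmod (?e f))\<^sup>2)"
    by (rule infsum_cong_neutral) (auto simp: fock_basis_def)
  then show ?thesis
    by (simp add: norm2_def fock_basis_def)
qed

definition truncate :: "'n list set \<Rightarrow> ('n::finite) coeffs \<Rightarrow> 'n coeffs" where
  "truncate A \<phi> = (\<lambda>f. if f \<in> A then \<phi> f else 0)"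

lemma truncate_in_fock_poly: "finite A \<Longrightarrow> truncate A \<phi> \<in> fock_poly"
  by (auto simp: fock_poly_eq truncate_def elim: finite_subset[rotated])

lemma truncate_in_fock:
  assumes "\<phi> \<in> fock"
  shows "truncate A \<phi> \<in> fock" and norm2_truncate_le: "norm2 (truncate A \<phi>) \<le> norm2 \<phi>"
proof -
  have "L2_set (\<lambda>f. cmod (truncate A \<phi> f)) B \<le> norm2 \<phi>" if "finite B" for B
  proof -
    have "L2_set (\<lambda>f. cmod (truncate A \<phi> f)) B \<le> L2_set (\<lambda>f. cmod (\<phi> f)) B"
      by (rule L2_set_mono) (auto simp: truncate_def)
    then show ?thesis
      using L2_set_le_norm2[OF assms that] by linarith
  qed
  then show "truncate A \<phi> \<in> fock" and "norm2 (truncate A \<phi>) \<le> norm2 \<phi>"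
    by (blast intro: fock_bound)+
qed

lemma fock_poly_subset_fock: "p \<in> fock_poly \<Longrightarrow> p \<in> fock"
  using fock_mult_poly_in_fock[OF fock_basis_in_fock[of "[]"]] by fastforce

lemma fock_poly_dense:
  assumes "\<phi> \<in> fock" and "\<epsilon> > 0"
  obtains p where "p \<in> fock_poly" and "norm2 (\<phi> - p) < \<epsilon>"
proof -
  let ?f = "\<lambda>f. (cmod (\<phi> f))\<^sup>2"
  have summable: "?f summable_on UNIV"
    using assms(1) by (simp add: fock_def)
  then obtain A where A: "finite A" and close: "\<bar>sum ?f A - infsum ?f UNIV\<bar> \<le> \<epsilon>\<^sup>2 / 2"
    using infsum_finite_approximation[OF summable, of "\<epsilon>\<^sup>2 / 2"] assms(2)
    by (auto simp: dist_real_def)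
  have "(norm2 (\<phi> - truncate A \<phi>))\<^sup>2 = infsum ?f (UNIV - A)"
    unfolding norm2_power2 by (rule infsum_cong_neutral) (auto simp: truncate_def)
  also have "\<dots> = infsum ?f UNIV - sum ?f A"
    using A summable by (subst infsum_Diff) auto
  also have "\<dots> < \<epsilon>\<^sup>2"
    using close assms(2) zero_less_power[of \<epsilon> 2] by linarith
  finally have "norm2 (\<phi> - truncate A \<phi>) < \<epsilon>"
    using assms(2) power_less_imp_less_base[of _ 2 \<epsilon>] by simp
  then show thesis
    using that truncate_in_fock_poly[OF A] by blast
qed

text \<open>
  Membership in \<^const>\<open>fock\<close> and the bound are read off from finitely many coefficients at a time,
  so coefficientwise convergence is enough for both.
\<close>

lemma fock_bound_of_coeff_limit:
  fixes u :: "nat \<Rightarrow> ('n::finite) coeffs"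
  assumes "\<And>h. (\<lambda>k. u k h) \<longlonglongrightarrow> v h" and "\<And>k. u k \<in> fock" and "\<And>k. norm2 (u k) \<le> B"
  shows "v \<in> fock" and "norm2 v \<le> B"
proof -
  have "L2_set (\<lambda>f. cmod (v f)) A \<le> B" if "finite A" for A
  proof (rule LIMSEQ_le_const2)
    show "(\<lambda>k. L2_set (\<lambda>f. cmod (u k f)) A) \<longlonglongrightarrow> L2_set (\<lambda>f. cmod (v f)) A"
      unfolding L2_set_def by (intro tendsto_intros assms)
    show "\<exists>N. \<forall>k\<ge>N. L2_set (\<lambda>f. cmod (u k f)) A \<le> B"
      using L2_set_le_norm2[OF assms(2) that] assms(3) order_trans by blast
  qed
  then show "v \<in> fock" and "norm2 v \<le> B"
    by (blast intro: fock_bound)+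
qed

section \<open>Bounded and bounded below multipliers\<close>

text \<open>
  The coefficients of \<open>\<phi> \<otimes>\<^sub>F g\<close> on a finite set \<open>A\<close> of words involve \<open>g\<close> only on the suffixes of
  words in \<open>A\<close>, of which there are finitely many. Hence every finite section of \<open>\<phi> \<otimes>\<^sub>F g\<close> is
  that of a product with a polynomial, and the bound on polynomials applies.
\<close>

lemma fock_mult_bound_extends:
  assumes poly: "\<And>p. p \<in> fock_poly \<Longrightarrow> norm2 (\<phi> \<otimes>\<^sub>F p) \<le> C * norm2 p"
    and "0 \<le> C" and \<phi>: "\<phi> \<in> fock" and g: "g \<in> fock"
  shows "\<phi> \<otimes>\<^sub>F g \<in> fock" and "norm2 (\<phi> \<otimes>\<^sub>F g) \<le> C * norm2 g"
proof -
  have "L2_set (\<lambda>f. cmod ((\<phi> \<otimes>\<^sub>F g) f)) A \<le> C * norm2 g" if A: "finite A" for A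
  proof -
    define T where "T = (\<Union>h\<in>A. (\<lambda>k. drop k h) ` {..length h})"
    define p where "p = truncate T g"
    have "finite T"
      using A by (simp add: T_def)
    then have p: "p \<in> fock_poly"
      by (simp add: p_def truncate_in_fock_poly)
    have "(\<phi> \<otimes>\<^sub>F g) h = (\<phi> \<otimes>\<^sub>F p) h" if "h \<in> A" for h
      unfolding fock_mult_eq_sum_splits
      using that by (intro sum.cong) (auto simp: p_def truncate_def T_def)
    then have "L2_set (\<lambda>f. cmod ((\<phi> \<otimes>\<^sub>F g) f)) A = L2_set (\<lambda>f. cmod ((\<phi> \<otimes>\<^sub>F p) f)) A"
      by (intro L2_set_cong) auto
    also have "\<dots> \<le> norm2 (\<phi> \<otimes>\<^sub>F p)"
      using A \<phi> p by (intro L2_set_le_norm2 fock_mult_poly_in_fock)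
    also have "\<dots> \<le> C * norm2 p"
      using p by (rule poly)
    also have "\<dots> \<le> C * norm2 g"
      unfolding p_def using \<open>0 \<le> C\<close> g by (intro mult_left_mono norm2_truncate_le)
    finally show ?thesis .
  qed
  then show "\<phi> \<otimes>\<^sub>F g \<in> fock" and "norm2 (\<phi> \<otimes>\<^sub>F g) \<le> C * norm2 g"
    by (blast intro: fock_bound)+
qed

lemma F_inf_poly_bound:
  assumes "\<phi> \<in> F_inf"
  obtains C where "0 \<le> C" and "\<And>p. p \<in> fock_poly \<Longrightarrow> norm2 (\<phi> \<otimes>\<^sub>F p) \<le> C * norm2 p"
proof -
  define C where "C = enn2real (norm_inf \<phi>)"
  have C: "norm_inf \<phi> = ennreal C"
    using assms by (simp add: C_def F_inf_def)
  have unit_ball: "norm2 (\<phi> \<otimes>\<^sub>F p) \<le> C" if "p \<in> fock_poly" "norm2 p \<le> 1" for p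
  proof -
    have "ennreal (norm2 (\<phi> \<otimes>\<^sub>F p)) \<le> ennreal C"
      unfolding C[symmetric] norm_inf_def using that by (intro SUP_upper) auto
    then show ?thesis
      by (simp add: C_def)
  qed
  have "norm2 (\<phi> \<otimes>\<^sub>F p) \<le> C * norm2 p" if p: "p \<in> fock_poly" for p
  proof (cases "norm2 p = 0")
    case True
    then have "p = 0"
      using p by (simp add: norm2_eq_0_iff fock_poly_subset_fock)
    then show ?thesis
      by (simp add: norm2_def fock_mult_def case_prod_unfold)
  next
    case False
    then have pos: "norm2 p > 0"
      using norm2_nonneg[of p] by simp
    define c :: complex where "c = of_real (1 / norm2 p)"
    have c: "cmod c = 1 / norm2 p"
      using pos by (simp add: c_def norm_divide)
    interpret module "fock_scale :: complex \<Rightarrow> 'a coeffs \<Rightarrow> 'a coeffs"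
      by (rule module_fock_scale)
    have "fock_scale c p \<in> fock_poly"
      using p unfolding fock_poly_def by (rule span_scale)
    moreover have "norm2 (fock_scale c p) \<le> 1"
      using pos by (simp add: norm2_scale c)
    ultimately have "norm2 (\<phi> \<otimes>\<^sub>F fock_scale c p) \<le> C"
      by (rule unit_ball)
    then show ?thesis
      using pos by (simp add: fock_mult_scale_right norm2_scale c divide_simps)
  qed
  then show thesis
    using that[of C] by (simp add: C_def)
qed

lemma F_inf_bounded:
  assumes "\<phi> \<in> F_inf"
  obtains C where "0 \<le> C"
    and "\<And>g. g \<in> fock \<Longrightarrow> \<phi> \<otimes>\<^sub>F g \<in> fock"
    and "\<And>g. g \<in> fock \<Longrightarrow> norm2 (\<phi> \<otimes>\<^sub>F g) \<le> C * norm2 g"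
proof -
  obtain C where "0 \<le> C" and "\<And>p. p \<in> fock_poly \<Longrightarrow> norm2 (\<phi> \<otimes>\<^sub>F p) \<le> C * norm2 p"
    using F_inf_poly_bound[OF assms] by blast
  moreover have "\<phi> \<in> fock"
    using assms by (simp add: F_inf_def)
  ultimately show thesis
    using that fock_mult_bound_extends by metis
qed

lemma F_infI:
  assumes "\<phi> \<in> fock" and "0 \<le> C"
    and poly: "\<And>p. p \<in> fock_poly \<Longrightarrow> norm2 (\<phi> \<otimes>\<^sub>F p) \<le> C * norm2 p"
  shows "\<phi> \<in> F_inf"
proof -
  have "norm_inf \<phi> \<le> ennreal C"
    unfolding norm_inf_def
  proof (rule SUP_least)
    fix p :: "'a coeffs"
    assume "p \<in> {p \<in> fock_poly. norm2 p \<le> 1}"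
    then have "norm2 (\<phi> \<otimes>\<^sub>F p) \<le> C * norm2 p" and "C * norm2 p \<le> C"
      using poly assms(2) by (auto intro: mult_left_le)
    then show "ennreal (norm2 (\<phi> \<otimes>\<^sub>F p)) \<le> ennreal C"
      by (intro ennreal_leI) simp
  qed
  then show ?thesis
    using assms(1) by (auto simp: F_inf_def intro: le_less_trans)
qed

text \<open>
  Both sides of the inequality are continuous in \<open>g\<close>, the right one because \<open>\<phi>\<close> is a bounded
  multiplier, and polynomials are dense.
\<close>

lemma lower_bound_extends:
  assumes "\<phi> \<in> F_inf" and "0 < \<delta>"
    and poly: "\<And>p. p \<in> fock_poly \<Longrightarrow> \<delta> * norm2 p \<le> norm2 (\<phi> \<otimes>\<^sub>F p)"
    and g: "g \<in> fock"
  shows "\<delta> * norm2 g \<le> norm2 (\<phi> \<otimes>\<^sub>F g)"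
proof -
  obtain C where C: "0 \<le> C"
    and mult: "\<And>g. g \<in> fock \<Longrightarrow> \<phi> \<otimes>\<^sub>F g \<in> fock"
    and bound: "\<And>g. g \<in> fock \<Longrightarrow> norm2 (\<phi> \<otimes>\<^sub>F g) \<le> C * norm2 g"
    using F_inf_bounded[OF assms(1)] by blast
  show ?thesis
  proof (rule field_le_epsilon)
    fix \<epsilon> :: real
    assume "0 < \<epsilon>"
    then have "0 < \<epsilon> / (C + \<delta>)"
      using C \<open>0 < \<delta>\<close> by simp
    then obtain p where p: "p \<in> fock_poly" and "norm2 (g - p) < \<epsilon> / (C + \<delta>)"
      using fock_poly_dense[OF g] by blast
    then have small: "C * norm2 (g - p) + \<delta> * norm2 (g - p) < \<epsilon>"
      using C \<open>0 < \<delta>\<close> by (simp add: pos_less_divide_eq algebra_simps)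
    have "p \<in> fock"
      using p by (rule fock_poly_subset_fock)
    have "norm2 g \<le> norm2 p + norm2 (g - p)"
      using fock_add(2)[OF \<open>p \<in> fock\<close> fock_diff[OF g \<open>p \<in> fock\<close>]] by simp
    then have "\<delta> * norm2 g \<le> \<delta> * norm2 p + \<delta> * norm2 (g - p)"
      using \<open>0 < \<delta>\<close> by (simp flip: distrib_left)
    also have "\<delta> * norm2 p \<le> norm2 (\<phi> \<otimes>\<^sub>F p)"
      using p by (rule poly)
    also have "norm2 (\<phi> \<otimes>\<^sub>F p) \<le> norm2 (\<phi> \<otimes>\<^sub>F g) + norm2 (\<phi> \<otimes>\<^sub>F (p - g))"
      using fock_add(2)[OF mult[OF g] mult[OF fock_diff[OF \<open>p \<in> fock\<close> g]]]
      by (simp add: fock_mult_diff_right)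
    also have "norm2 (\<phi> \<otimes>\<^sub>F (p - g)) \<le> C * norm2 (g - p)"
      using bound[OF fock_diff[OF \<open>p \<in> fock\<close> g]] by (simp add: norm2_minus_commute)
    finally show "\<delta> * norm2 g \<le> norm2 (\<phi> \<otimes>\<^sub>F g) + \<epsilon>"
      using small by linarith
  qed
qed

section \<open>Invertibility\<close>

lemma fock_closure_eq_iff:
  "fock_topology closure_of S = fock \<longleftrightarrow>
     (\<forall>\<phi>\<in>fock. \<forall>\<epsilon>>0. \<exists>\<psi>\<in>S \<inter> fock. norm2 (\<psi> - \<phi>) < \<epsilon>)"
proof -
  interpret Metric_space fock "\<lambda>\<phi> \<psi>. norm2 (\<phi> - \<psi>)"
    by (rule Metric_space_fock)
  show ?thesis
    unfolding fock_topology_def metric_closure_of in_mball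
    by (auto simp: norm2_minus_commute set_eq_iff)
qed

lemma invertible_imp_outer:
  assumes \<phi>: "\<phi> \<in> F_inf" and \<psi>: "\<psi> \<in> F_inf" and inv: "\<phi> \<otimes>\<^sub>F \<psi> = fock_basis []"
  shows "outer \<phi>"
proof -
  have "h \<in> (\<lambda>g. \<phi> \<otimes>\<^sub>F g) ` fock" if "h \<in> fock" for h
  proof
    show "h = \<phi> \<otimes>\<^sub>F (\<psi> \<otimes>\<^sub>F h)"
      by (simp add: inv flip: fock_mult_assoc)
    show "\<psi> \<otimes>\<^sub>F h \<in> fock"
      using F_inf_bounded[OF \<psi>] that by blast
  qed
  then have "\<exists>\<psi>\<in>(\<lambda>g. \<phi> \<otimes>\<^sub>F g) ` fock \<inter> fock. norm2 (\<psi> - h) < \<epsilon>"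
    if "h \<in> fock" and "\<epsilon> > 0" for h \<epsilon>
    using that by (intro bexI[of _ h]) (auto simp: norm2_def)
  then show ?thesis
    using \<phi> unfolding outer_def fock_closure_eq_iff by blast
qed

lemma invertible_imp_lower_bound:
  assumes \<phi>: "\<phi> \<in> F_inf" and \<psi>: "\<psi> \<in> F_inf" and inv: "\<psi> \<otimes>\<^sub>F \<phi> = fock_basis []"
  shows "\<exists>\<delta>>0. \<forall>p\<in>fock_poly. norm2 (\<phi> \<otimes>\<^sub>F p) \<ge> \<delta> * norm2 p"
proof -
  obtain C where C: "0 \<le> C"
    and "\<And>g. g \<in> fock \<Longrightarrow> \<psi> \<otimes>\<^sub>F g \<in> fock"
    and bound: "\<And>g. g \<in> fock \<Longrightarrow> norm2 (\<psi> \<otimes>\<^sub>F g) \<le> C * norm2 g"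
    using F_inf_bounded[OF \<psi>] by blast
  \<comment> \<open>\<open>C + 1\<close> instead of \<open>C\<close>, so that the denominator is positive.\<close>
  have "1 / (C + 1) * norm2 p \<le> norm2 (\<phi> \<otimes>\<^sub>F p)" if p: "p \<in> fock_poly" for p
  proof -
    have "\<phi> \<otimes>\<^sub>F p \<in> fock"
      using \<phi> p by (simp add: F_inf_def fock_mult_poly_in_fock)
    then have "norm2 (\<psi> \<otimes>\<^sub>F (\<phi> \<otimes>\<^sub>F p)) \<le> C * norm2 (\<phi> \<otimes>\<^sub>F p)"
      by (rule bound)
    also have "\<dots> \<le> (C + 1) * norm2 (\<phi> \<otimes>\<^sub>F p)"
      by (intro mult_right_mono norm2_nonneg) simp
    finally have "norm2 p \<le> (C + 1) * norm2 (\<phi> \<otimes>\<^sub>F p)"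
      by (simp add: inv flip: fock_mult_assoc)
    then show ?thesis
      using C by (simp add: divide_simps mult.commute)
  qed
  then show ?thesis
    using C by (intro exI[of _ "1 / (C + 1)"]) auto
qed

lemma outer_approximates_unit:
  fixes \<phi> :: "('n::finite) coeffs"
  assumes "outer \<phi>"
  obtains g :: "nat \<Rightarrow> 'n coeffs"
  where "\<And>k. g k \<in> fock" and "\<And>k. \<phi> \<otimes>\<^sub>F g k \<in> fock"
    and "\<And>k. norm2 (\<phi> \<otimes>\<^sub>F g k - fock_basis []) < inverse (real (Suc k))"
proof -
  have "\<exists>g\<in>fock. \<phi> \<otimes>\<^sub>F g \<in> fock \<and> norm2 (\<phi> \<otimes>\<^sub>F g - fock_basis []) < inverse (real (Suc k))" for k
  proof -
    have "\<forall>h\<in>fock. \<forall>\<epsilon>>0. \<exists>\<psi>\<in>(\<lambda>g. \<phi> \<otimes>\<^sub>F g) ` fock \<inter> fock. norm2 (\<psi> - h) < \<epsilon>"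
      using assms unfolding outer_def fock_closure_eq_iff by blast
    from this[rule_format, OF fock_basis_in_fock[of "[]"], of "inverse (real (Suc k))"]
    show ?thesis
      by auto
  qed
  then show thesis
    using that by metis
qed

text \<open>
  If \<open>\<phi> [] = 0\<close>, no product \<open>\<phi> \<otimes>\<^sub>F g\<close> has a nonzero constant coefficient, so the square
  summable ones among them have distance at least \<open>1\<close> from the unit.
\<close>

lemma outer_Nil_nonzero:
  assumes "outer \<phi>"
  shows "\<phi> [] \<noteq> 0"
proof
  assume 0: "\<phi> [] = 0"
  obtain g :: "nat \<Rightarrow> 'a coeffs" where "\<And>k. g k \<in> fock" and fock: "\<And>k. \<phi> \<otimes>\<^sub>F g k \<in> fock"
    and close: "\<And>k. norm2 (\<phi> \<otimes>\<^sub>F g k - fock_basis []) < inverse (real (Suc k))"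
    using outer_approximates_unit[OF assms] by blast
  have "cmod ((\<phi> \<otimes>\<^sub>F g 0 - fock_basis []) []) \<le> norm2 (\<phi> \<otimes>\<^sub>F g 0 - fock_basis [])"
    by (intro cmod_le_norm2 fock_diff fock fock_basis_in_fock)
  then show False
    using close[of 0] 0 by (simp add: fock_mult_Nil fock_basis_def)
qed

text \<open>
  The formal inverse \<open>\<psi>\<close> is the coefficientwise limit of a sequence \<open>g\<close> for which
  \<open>\<phi> \<otimes>\<^sub>F g k\<close> tends to the unit. The lower bound serves twice: it bounds \<open>g\<close> in norm, hence
  \<open>\<psi>\<close> is square summable; applied to \<open>\<psi> \<otimes>\<^sub>F p\<close>, it makes \<open>\<psi>\<close> a bounded multiplier.
\<close>

lemma outer_bounded_below_imp_invertible:
  fixes \<phi> :: "('n::finite) coeffs"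
  assumes outer: "outer \<phi>" and \<delta>: "0 < \<delta>"
    and poly: "\<And>p. p \<in> fock_poly \<Longrightarrow> \<delta> * norm2 p \<le> norm2 (\<phi> \<otimes>\<^sub>F p)"
  shows "invertible_F_inf \<phi>"
proof -
  have \<phi>: "\<phi> \<in> F_inf"
    using outer by (simp add: outer_def)
  have lower: "norm2 g \<le> norm2 (\<phi> \<otimes>\<^sub>F g) / \<delta>" if "g \<in> fock" for g
    using lower_bound_extends[OF \<phi> \<delta> poly that] \<delta> by (simp add: field_simps)
  obtain \<psi> where right: "\<phi> \<otimes>\<^sub>F \<psi> = fock_basis []" and left: "\<psi> \<otimes>\<^sub>F \<phi> = fock_basis []"
    using fock_mult_inverse_exists[of \<phi>] outer_Nil_nonzero[OF outer] by blast
  obtain g :: "nat \<Rightarrow> 'n coeffs" where g: "\<And>k. g k \<in> fock" and \<phi>g: "\<And>k. \<phi> \<otimes>\<^sub>F g k \<in> fock"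
    and close: "\<And>k. norm2 (\<phi> \<otimes>\<^sub>F g k - fock_basis []) < inverse (real (Suc k))"
    using outer_approximates_unit[OF outer] by blast

  have \<phi>g_lim: "(\<lambda>k. (\<phi> \<otimes>\<^sub>F g k) h) \<longlonglongrightarrow> fock_basis [] h" for h
  proof (rule LIM_zero_cancel, rule Lim_null_comparison)
    have "cmod ((\<phi> \<otimes>\<^sub>F g k - fock_basis []) h) \<le> inverse (real (Suc k))" for k
      using cmod_le_norm2[OF fock_diff[OF \<phi>g fock_basis_in_fock], of k "[]" h] close[of k]
      by linarith
    then show "\<forall>\<^sub>F k in sequentially.
        norm ((\<phi> \<otimes>\<^sub>F g k) h - fock_basis [] h) \<le> inverse (real (Suc k))"
      by simp
  qed (rule LIMSEQ_inverse_real_of_nat)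
  have "(\<lambda>k. (\<psi> \<otimes>\<^sub>F (\<phi> \<otimes>\<^sub>F g k)) h) \<longlonglongrightarrow> (\<psi> \<otimes>\<^sub>F fock_basis []) h" for h
    by (rule tendsto_fock_mult_right) (rule \<phi>g_lim)
  then have g_lim: "(\<lambda>k. g k h) \<longlonglongrightarrow> \<psi> h" for h
    by (simp add: left flip: fock_mult_assoc)

  have g_bound: "norm2 (g k) \<le> 2 / \<delta>" for k
  proof -
    have "inverse (real (Suc k)) \<le> 1"
      by (simp add: field_simps)
    then have "norm2 (\<phi> \<otimes>\<^sub>F g k - fock_basis []) \<le> 1"
      using close[of k] by linarith
    moreover have "norm2 (\<phi> \<otimes>\<^sub>F g k) \<le> norm2 (\<phi> \<otimes>\<^sub>F g k - fock_basis []) + norm2 (fock_basis [] :: 'n coeffs)"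
      using fock_add(2)[OF fock_diff[OF \<phi>g fock_basis_in_fock] fock_basis_in_fock, of k "[]" "[]"]
      by simp
    ultimately have "norm2 (\<phi> \<otimes>\<^sub>F g k) \<le> 2"
      by (simp add: norm2_unit)
    then show ?thesis
      using lower[OF g, of k] \<delta> divide_right_mono[of _ 2 \<delta>] by fastforce
  qed
  have \<psi>: "\<psi> \<in> fock"
    using g_lim g g_bound by (rule fock_bound_of_coeff_limit(1))
  have "\<psi> \<in> F_inf"
  proof (rule F_infI[OF \<psi>])
    fix p :: "'n coeffs"
    assume "p \<in> fock_poly"
    then have "norm2 (\<psi> \<otimes>\<^sub>F p) \<le> norm2 (\<phi> \<otimes>\<^sub>F (\<psi> \<otimes>\<^sub>F p)) / \<delta>"
      using \<psi> by (intro lower fock_mult_poly_in_fock)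
    then show "norm2 (\<psi> \<otimes>\<^sub>F p) \<le> 1 / \<delta> * norm2 p"
      by (simp add: right flip: fock_mult_assoc)
  qed (use \<delta> in simp)
  then show ?thesis
    unfolding invertible_F_inf_def using left right by blast
qed

theorem theorem2p8:
  fixes \<phi> :: "('n::finite) coeffs"
  assumes "\<phi> \<in> F_inf"
  shows "invertible_F_inf \<phi> \<longleftrightarrow>
    outer \<phi> \<and> (\<exists>\<delta>>0. \<forall>p\<in>fock_poly. norm2 (\<phi> \<otimes>\<^sub>F p) \<ge> \<delta> * norm2 p)"
  using invertible_imp_outer[OF assms] invertible_imp_lower_bound[OF assms]
    outer_bounded_below_imp_invertible[of \<phi>]
  unfolding invertible_F_inf_def by blast

end
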